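(* Let $a_{1}, \ldots, a_{2m}$ and $c_1,c_2,\ldots, c_{k}$ be sequences of integers such that the continued fractions $[a_{1}, \ldots, a_{2m}]$ and $[\![c_1,c_2,\ldots, c_{k}]\!]$ are well defined and are equal to the same rational number $\frac{r}{s}$. Then $$[a_{1}, \ldots, a_{2m}]_{q}=[\![c_1,c_2,\ldots, c_{k}]\!]_{q}=\left[\frac{r}{s}\right]_{q}.$$
   Context: For $n\in\mathbb{Z}_{>0}$, $[n]_q=1+q+\cdots+q^{n-1}$, $[-n]_q=-q^{-1}-\cdots-q^{-n}$, $[0]_q=0$. For integers $a_i$, $[a_1,\ldots,a_{2m}]$ denotes the regular-type continued fraction $a_1+\cfrac{1}{a_2+\cfrac{1}{\ddots+\cfrac{1}{a_{2m}}}}$ and $[a_1,\ldots,a_{2m}]_q$ denotes its $q$-deformation $[a_1]_{q} + \cfrac{q^{a_{1}}}{[a_2]_{q^{-1}} + \cfrac{q^{-a_{2}}}{[a_{3}]_{q} +\cfrac{q^{a_{3}}}{\ddots+\cfrac{q^{a_{2m-1}}}{[a_{2m}]_{q^{-1}}}}}}$. For integers $c_i$, $[\![c_1,\ldots,c_k]\!]$ denotes the negative (Hirzebruch–Jung) continued fraction $c_1-\cfrac{1}{c_2-\cfrac{1}{\ddots-\cfrac{1}{c_k}}}$ and $[\![c_1,\ldots,c_k]\!]_q$ denotes its $q$-deformation $[c_1]_{q} - \cfrac{q^{c_{1}-1}}{[c_2]_{q} - \cfrac{q^{c_{2}-1}}{\ddots - \cfrac{q^{c_{k-1}-1}}{[c_{k}]_{q}}}}$.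 For a rational $\frac{r}{s}$ (coprime, $s>0$), $[\frac{r}{s}]_q$ is defined as $[a_1,\ldots,a_{2m}]_q$ where $\frac rs=[a_1,\ldots,a_{2m}]$ is the unique expansion with $a_1\in\mathbb{Z}$ and $a_i\ge1$ for $i\ge2$. *)

theory Defs
  imports
    Complex_Main
    "HOL-Computational_Algebra.Polynomial"
    "HOL-Computational_Algebra.Fraction_Field"
begin

definition qvar :: "int poly fract" where
  "qvar = Fract [:0, 1:] 1"

text \<open>The q-integer \<open>[n]\<^sub>q\<close>; the value \<open>[n]\<close> at \<open>q\<^sup>-\<^sup>1\<close> is \<open>qint (inverse q) n\<close>.\<close>

definition qint :: "'a::field \<Rightarrow> int \<Rightarrow> 'a" where
  "qint q n = (if n \<ge> 0 then (\<Sum>i<nat n. q ^ i) else - (\<Sum>i=1..nat (- n). inverse q ^ i))"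

text \<open>
  Continued fractions are given by nonempty lists of integers (nothing is specified for the empty
  list). Since \<open>x / 0 = 0\<close> in HOL, each one comes with a predicate saying that none of the
  denominators occurring in it vanishes, that is, that it is well defined.
\<close>

fun cf :: "int list \<Rightarrow> rat" where
  "cf [a] = of_int a"
| "cf (a # b # xs) = of_int a + 1 / cf (b # xs)"

fun cf_defined :: "int list \<Rightarrow> bool" where
  "cf_defined [a] \<longleftrightarrow> True"
| "cf_defined (a # b # xs) \<longleftrightarrow> cf_defined (b # xs) \<and> cf (b # xs) \<noteq> 0"

fun hj :: "int list \<Rightarrow> rat" where
  "hj [c] = of_int c"
| "hj (c # d # xs) = of_int c - 1 / hj (d # xs)"

fun hj_defined :: "int list \<Rightarrow> bool" where
  "hj_defined [c] \<longleftrightarrow> True"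
| "hj_defined (c # d # xs) \<longleftrightarrow> hj_defined (d # xs) \<and> hj (d # xs) \<noteq> 0"

text \<open>
  Replacing \<open>q\<close> by its inverse in the recursive call produces the alternation between
  \<open>[a]\<close> at \<open>q\<close> with numerator \<open>q\<close> to the \<open>a\<close> and \<open>[a]\<close> at the inverse of \<open>q\<close> with
  numerator \<open>q\<close> to the \<open>-a\<close>.
\<close>

fun qcf :: "'a::field \<Rightarrow> int list \<Rightarrow> 'a" where
  "qcf q [a] = qint q a"
| "qcf q (a # b # xs) = qint q a + q powi a / qcf (inverse q) (b # xs)"

fun qcf_defined :: "'a::field \<Rightarrow> int list \<Rightarrow> bool" where
  "qcf_defined q [a] \<longleftrightarrow> True"
| "qcf_defined q (a # b # xs) \<longleftrightarrow>
     qcf_defined (inverse q) (b # xs) \<and> qcf (inverse q) (b # xs) \<noteq> 0"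

fun qhj :: "'a::field \<Rightarrow> int list \<Rightarrow> 'a" where
  "qhj q [c] = qint q c"
| "qhj q (c # d # xs) = qint q c - q powi (c - 1) / qhj q (d # xs)"

fun qhj_defined :: "'a::field \<Rightarrow> int list \<Rightarrow> bool" where
  "qhj_defined q [c] \<longleftrightarrow> True"
| "qhj_defined q (c # d # xs) \<longleftrightarrow> qhj_defined q (d # xs) \<and> qhj q (d # xs) \<noteq> 0"

definition regular_expansion :: "rat \<Rightarrow> int list \<Rightarrow> bool" where
  "regular_expansion x as \<longleftrightarrow>
     as \<noteq> [] \<and> even (length as) \<and> (\<forall>a\<in>set (tl as). a \<ge> 1) \<and> cf_defined as \<and> cf as = x"

definition qrat :: "'a::field \<Rightarrow> rat \<Rightarrow> 'a" where
  "qrat q x = qcf q (THE as. regular_expansion x as)"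

text \<open>The expansion selected in the definition of \<open>qrat\<close> exists and is unique.\<close>

lemma cf_bounds:
  assumes "as \<noteq> []" "\<forall>a\<in>set (tl as). a \<ge> 1"
  shows "(odd (length as) \<longrightarrow> of_int (hd as) \<le> cf as \<and> cf as < of_int (hd as) + 1) \<and>
         (even (length as) \<longrightarrow> of_int (hd as) < cf as \<and> cf as \<le> of_int (hd as) + 1)"
  using assms
proof (induction as rule: cf.induct)
  case (2 a b xs)
  have b: "(of_int b :: rat) \<ge> 1"
    using "2.prems" by simp
  have IH: "(odd (length (b # xs)) \<longrightarrow> of_int b \<le> cf (b # xs)) \<and>
            (even (length (b # xs)) \<longrightarrow> of_int b < cf (b # xs))"
    using "2.IH" "2.prems" by auto
  show ?case
  proof (cases "even (length (b # xs))")
    case True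
    hence "cf (b # xs) > 1" using IH b by linarith
    thus ?thesis using True by simp
  next
    case False
    hence "cf (b # xs) \<ge> 1" using IH b by linarith
    thus ?thesis using False by simp
  qed
qed auto

lemma cf_tail_pos:
  assumes "\<forall>a\<in>set (b # xs). a \<ge> 1"
  shows "cf (b # xs) > 0"
proof -
  have "(of_int b :: rat) \<ge> 1" using assms by simp
  moreover have "of_int b \<le> cf (b # xs)"
    using cf_bounds[of "b # xs"] assms by (cases "even (length (b # xs))") auto
  ultimately show ?thesis by linarith
qed

lemma cf_defined_regular:
  "as \<noteq> [] \<Longrightarrow> \<forall>a\<in>set (tl as). a \<ge> 1 \<Longrightarrow> cf_defined as"
proof (induction as rule: cf_defined.induct)
  case (2 a b xs)
  thus ?case using cf_tail_pos[of b xs] by simp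
qed auto

lemma cf_regular_inject:
  assumes "as \<noteq> []" "bs \<noteq> []" "\<forall>a\<in>set (tl as). a \<ge> 1" "\<forall>b\<in>set (tl bs). b \<ge> 1"
    and "even (length as) = even (length bs)" "cf as = cf bs"
  shows "as = bs"
  using assms
proof (induction as arbitrary: bs rule: cf.induct)
  case (1 a)
  then obtain b ys where bs: "bs = b # ys" by (cases bs) auto
  have "of_int b \<le> (of_int a :: rat)" "(of_int a :: rat) < of_int b + 1"
    using cf_bounds[of bs] 1 bs by auto
  hence "a = b" by linarith
  moreover have "ys = []"
  proof (cases ys)
    case (Cons y zs)
    hence "cf (y # zs) > 0" using cf_tail_pos[of y zs] 1 bs by auto
    thus ?thesis using 1 bs Cons \<open>a = b\<close> by simp
  qed
  ultimately show ?case using bs by simp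
next
  case (2 a a' xs)
  then obtain b ys where bs: "bs = b # ys" by (cases bs) auto
  have pos: "cf (a' # xs) > 0" using cf_tail_pos[of a' xs] 2 by auto
  have "(of_int a :: rat) < of_int b + 1" "(of_int b :: rat) < of_int a + 1"
    using cf_bounds[of bs] cf_bounds[of "a # a' # xs"] 2 bs
    by (cases "even (length bs)"; force)+
  hence "a = b" by linarith
  obtain b' zs where ys: "ys = b' # zs"
    using "2.prems"(6) pos bs \<open>a = b\<close> by (cases ys) auto
  have "cf (a' # xs) = cf (b' # zs)"
    using "2.prems"(6) bs ys \<open>a = b\<close> by simp
  hence "a' # xs = b' # zs"
    using 2 bs ys by (intro "2.IH") auto
  thus ?case using bs ys \<open>a = b\<close> by simp
qed auto

lemma regular_expansion_exists:
  assumes "s > 0"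
  shows "\<exists>as. regular_expansion (of_int r / of_int s) as"
  using assms
proof (induction "nat s" arbitrary: r s rule: less_induct)
  case less
  define a where "a = (r - 1) div s"
  define u where "u = r - a * s"
  define b where "b = s div u"
  define v where "v = s mod u"
  have "u = (r - 1) mod s + 1"
    by (simp add: u_def a_def minus_div_mult_eq_mod [symmetric])
  hence u: "0 < u" "u \<le> s"
    using less.prems pos_mod_bound[of s "r - 1"] pos_mod_sign[of s "r - 1"] by linarith+
  have b: "b \<ge> 1"
    using u pos_imp_zdiv_pos_iff[of u s] unfolding b_def by linarith
  have v: "0 \<le> v" "v < u" "s = b * u + v"
    using u by (simp_all add: v_def b_def)
  have rs: "(of_int r :: rat) / of_int s = of_int a + 1 / (of_int s / of_int u)"
  proof -
    have "r = a * s + u" by (simp add: u_def)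
    thus ?thesis using u by (simp add: field_simps)
  qed
  have su: "(of_int s :: rat) / of_int u = of_int b + of_int v / of_int u"
    using u v by (simp add: field_simps)
  show ?case
  proof (cases "v = 0")
    case True
    hence "regular_expansion (of_int r / of_int s) [a, b]"
      using rs su b by (auto simp: regular_expansion_def)
    thus ?thesis by blast
  next
    case False
    hence "v > 0" using v by simp
    then obtain as where as: "regular_expansion (of_int u / of_int v) as"
      using less.hyps[of v u] u v by auto
    then obtain c xs where c: "as = c # xs"
      by (cases as) (auto simp: regular_expansion_def)
    have "1 < (of_int u :: rat) / of_int v"
      using v \<open>v > 0\<close> by simp
    also have "\<dots> \<le> of_int c + 1"
      using as cf_bounds[of as] c by (auto simp: regular_expansion_def)
    finally have "c \<ge> 1" by simp
    hence "regular_expansion (of_int r / of_int s) (a # b # as)"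
      using as b c rs su cf_defined_regular[of "a # b # as"]
      by (auto simp: regular_expansion_def)
    thus ?thesis by blast
  qed
qed

lemma regular_expansion_unique: "\<exists>!as. regular_expansion x as"
proof -
  obtain r s where "s > 0" "x = of_int r / of_int s"
    by (cases x) (auto simp: Fract_of_int_quotient)
  hence "\<exists>as. regular_expansion x as"
    using regular_expansion_exists by blast
  moreover have "as = bs" if "regular_expansion x as" "regular_expansion x bs" for as bs
    using that cf_regular_inject[of as bs] by (simp add: regular_expansion_def)
  ultimately show ?thesis by blast
qed

end

theory Submission
  imports Defs
begin

text \<open>
  Translation by integers, negation and inversion of a rational number lift to transformations of
  its q-deformation, as soon as \<open>q > 0\<close> in an ordered field: positivity then excludes every
  vanishing denominator. Each of the two continued fraction algorithms is a composition of such
  steps, so that it computes the q-deformation of the rational number it expands. The field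
  of rational functions is ordered by letting the variable be infinitely large.
\<close>

section \<open>Arithmetic of q-integers\<close>

lemma qint_0 [simp]: "qint q 0 = 0"
  by (simp add: qint_def)

lemma qint_1 [simp]: "qint q 1 = 1"
  by (simp add: qint_def)

lemma qint_add_1:
  assumes "q \<noteq> 0"
  shows "qint q (n + 1) = qint q n + q powi n"
proof (cases "n \<ge> 0")
  case True
  thus ?thesis by (simp add: qint_def nat_add_distrib power_int_def)
next
  case False
  \<comment> \<open>The sums for n + 1 = -k and n = -(k + 1) differ only in the last term, which is
    \<open>q powi n\<close>.\<close>
  define k where "k = nat (- n - 1)"
  have n: "n = - int (Suc k)" using False by (simp add: k_def)
  have "qint q (n + 1) = - (\<Sum>i=1..k. inverse q ^ i)"
    by (simp add: qint_def n)
  moreover have "qint q n = - (\<Sum>i=1..Suc k. inverse q ^ i)"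
    unfolding qint_def n by (simp del: of_nat_Suc)
  moreover have "q powi n = inverse q ^ Suc k"
    unfolding n power_int_def by (simp del: of_nat_Suc)
  ultimately show ?thesis by simp
qed

lemma qint_add:
  assumes "q \<noteq> 0"
  shows "qint q (n + a) = qint q n + q powi n * qint q a"
proof (induction a rule: int_induct[where k = 0])
  case (step1 i)
  have "qint q (n + (i + 1)) = qint q (n + i) + q powi (n + i)"
    using qint_add_1[OF assms, of "n + i"] by (simp add: add.assoc)
  thus ?case
    using step1 assms qint_add_1[OF assms, of i] by (simp add: power_int_add distrib_left)
next
  case (step2 i)
  have "qint q (n + i) = qint q (n + (i - 1)) + q powi (n + (i - 1))"
    using qint_add_1[OF assms, of "n + (i - 1)"] by (simp add: algebra_simps)
  moreover have "qint q i = qint q (i - 1) + q powi (i - 1)"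
    using qint_add_1[OF assms, of "i - 1"] by simp
  moreover have "q powi (n + (i - 1)) = q powi n * q powi (i - 1)"
    using assms by (intro power_int_add) simp
  ultimately show ?case
    using step2 by (simp add: algebra_simps)
qed simp

text \<open>Integer case of \<open>qrat_uminus\<close>. For positive n the factor 1/q arises because
  the sum for -n starts at exponent 1 instead of 0.\<close>

lemma qint_uminus:
  assumes "q \<noteq> 0"
  shows "qint q (- n) = - (qint (inverse q) n / q)"
proof (induction n rule: int_induct[where k = 0])
  case (step1 i)
  have "qint q (- i) = qint q (- (i + 1)) + q powi (- (i + 1))"
    using qint_add_1[OF assms, of "- (i + 1)"] by simp
  moreover have "q powi (- (i + 1)) = inverse q powi i / q"
    using assms by (simp only: power_int_minus power_int_inverse) (simp add: power_int_add divide_inverse)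
  ultimately have "qint q (- (i + 1)) = - (qint (inverse q) i / q) - inverse q powi i / q"
    using step1 by (simp add: algebra_simps)
  thus ?case
    using assms qint_add_1[of "inverse q" i] by (simp add: add_divide_distrib)
next
  case (step2 i)
  have "qint q (- (i - 1)) = qint q (- i) + q powi (- i)"
    using qint_add_1[OF assms, of "- i"] by simp
  moreover have "q powi (- i) = inverse q powi (i - 1) / q"
    using assms by (simp add: power_int_minus power_int_diff power_int_inverse field_simps)
  ultimately show ?case
    using step2 assms qint_add_1[of "inverse q" "i - 1"] by (simp add: add_divide_distrib)
qed simp

lemma qint_pos:
  fixes q :: "'a::linordered_field"
  assumes "q > 0" "n \<ge> 1"
  shows "qint q n > 0"
  using assms by (auto simp: qint_def lessThan_empty_iff intro!: sum_pos)

section \<open>Regular expansions of either parity\<close>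

lemma cf_Cons: "xs \<noteq> [] \<Longrightarrow> cf (a # xs) = of_int a + 1 / cf xs"
  by (cases xs) auto

lemma qcf_Cons: "xs \<noteq> [] \<Longrightarrow> qcf q (a # xs) = qint q a + q powi a / qcf (inverse q) xs"
  by (cases xs) auto

lemma qcf_pos:
  fixes q :: "'a::linordered_field"
  assumes "q > 0" "as \<noteq> []" "\<forall>a\<in>set as. a \<ge> 1"
  shows "qcf q as > 0"
  using assms
proof (induction q as rule: qcf.induct)
  case (1 q a)
  thus ?case by (simp add: qint_pos)
next
  case (2 q a b xs)
  thus ?case by (auto intro!: add_pos_pos qint_pos divide_pos_pos zero_less_power_int)
qed auto

text \<open>The clause on the head keeps the modified list regular after prepending further entries.\<close>

lemma regular_flip_parity:
  assumes "as \<noteq> []" "\<forall>a\<in>set (tl as). a \<ge> 1"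
  shows "\<exists>bs. bs \<noteq> [] \<and> (\<forall>b\<in>set (tl bs). b \<ge> 1) \<and> even (length bs) = odd (length as) \<and>
           (length as \<ge> 2 \<longrightarrow> hd as \<le> hd bs) \<and> cf bs = cf as \<and>
           (\<forall>q::'a::field. q \<noteq> 0 \<longrightarrow> qcf q bs = qcf q as)"
  using assms
proof (induction as rule: induct_list012)
  case (2 a)
  have "qcf q [a - 1, 1] = qcf q [a]" if "q \<noteq> 0" for q :: 'a
    using qint_add_1[OF that, of "a - 1"] by simp
  thus ?case by (intro exI[of _ "[a - 1, 1]"]) simp
next
  case (3 a b xs)
  show ?case
  proof (cases xs)
    case Nil
    show ?thesis
    \<comment> \<open>Splitting off a final 1 would leave the forbidden entry 0 when b = 1. In that
      case b is absorbed into a, and the head grows, as the clause on it permits.\<close>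
    proof (cases "b = 1")
      case True
      thus ?thesis
        using Nil by (intro exI[of _ "[a + 1]"]) (simp add: qint_add_1)
    next
      case False
      hence "b \<ge> 2" using 3 by simp
      have "qcf q [a, b - 1, 1] = qcf q [a, b]" if "q \<noteq> 0" for q :: 'a
        using qint_add_1[of "inverse q" "b - 1"] that by simp
      thus ?thesis
        using Nil \<open>b \<ge> 2\<close> by (intro exI[of _ "[a, b - 1, 1]"]) simp
    qed
  next
    case (Cons c ys)
    obtain bs where bs: "bs \<noteq> []" "\<forall>b\<in>set (tl bs). b \<ge> 1"
      "even (length bs) = odd (length (b # xs))" "b \<le> hd bs" "cf bs = cf (b # xs)"
      "\<And>q::'a. q \<noteq> 0 \<Longrightarrow> qcf q bs = qcf q (b # xs)"
      using "3.IH"(2) "3.prems" Cons by auto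
    have "\<forall>b\<in>set bs. b \<ge> 1"
      using bs "3.prems" by (cases bs) auto
    thus ?thesis
      using bs by (intro exI[of _ "a # bs"]) (simp add: cf_Cons qcf_Cons)
  qed
qed simp

text \<open>Frees \<open>qrat\<close> from even length by \<open>regular_flip_parity\<close>, so
  that single entries can later be prepended or deleted.\<close>

lemma qrat_eqI:
  assumes "as \<noteq> []" "\<forall>a\<in>set (tl as). a \<ge> 1" "cf as = x" "q \<noteq> 0"
  shows "qrat q x = qcf q as"
proof -
  have even_case: "qrat q x = qcf q bs"
    if "even (length bs)" "bs \<noteq> []" "\<forall>b\<in>set (tl bs). b \<ge> 1" "cf bs = x" for bs
  proof -
    have "regular_expansion x bs"
      using that by (simp add: regular_expansion_def cf_defined_regular)
    hence "(THE as. regular_expansion x as) = bs"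
      using regular_expansion_unique by (intro the1_equality) auto
    thus ?thesis by (simp add: qrat_def)
  qed
  show ?thesis
  proof (cases "even (length as)")
    case True
    thus ?thesis using even_case assms by blast
  next
    case False
    then obtain bs where "bs \<noteq> []" "\<forall>b\<in>set (tl bs). b \<ge> 1" "even (length bs)" "cf bs = x"
      "qcf q bs = qcf q as"
      using regular_flip_parity[where ?'a = 'a, OF assms(1,2)] assms(3,4) by auto
    thus ?thesis using even_case by simp
  qed
qed

section \<open>Translation, inversion and negation\<close>

lemma qrat_of_int: "q \<noteq> 0 \<Longrightarrow> qrat q (of_int n) = qint q n"
  using qrat_eqI[of "[n]" "of_int n" q] by simp

lemma qrat_0: "q \<noteq> 0 \<Longrightarrow> qrat q 0 = 0"
  using qrat_of_int[of q 0] by simp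

lemma regular_expansionE:
  obtains a b xs where "regular_expansion x (a # b # xs)"
proof -
  obtain as where "regular_expansion x as"
    using regular_expansion_unique by blast
  thus thesis
    using that by (cases as rule: cf.cases) (auto simp: regular_expansion_def)
qed

text \<open>The first entry of a regular expansion may be any integer, so a translation changes this
  entry only and \<open>qint_add\<close> applies.\<close>

lemma qrat_of_int_add:
  assumes "q \<noteq> 0"
  shows "qrat q (of_int n + x) = qint q n + q powi n * qrat q x"
proof -
  obtain a b xs where as: "regular_expansion x (a # b # xs)"
    by (rule regular_expansionE)
  have "qrat q x = qcf q (a # b # xs)"
    using as assms by (intro qrat_eqI) (auto simp: regular_expansion_def)
  moreover have "qrat q (of_int n + x) = qcf q ((n + a) # b # xs)"
    using as assms by (intro qrat_eqI) (auto simp: regular_expansion_def)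
  ultimately show ?thesis
    using assms qint_add[OF assms, of n a] by (simp add: power_int_add distrib_left)
qed

text \<open>The two forms are those between which inversion switches. The first entry a of the even
  expansion satisfies 0 < x \<le> a + 1, hence a \<ge> 0; the forms correspond to a > 0 and a =
  0.\<close>

lemma pos_expansion:
  fixes x :: rat
  assumes "x > 0"
  obtains as where "as \<noteq> []" "\<forall>a\<in>set as. a \<ge> 1" "cf as = x"
  | as where "as \<noteq> []" "\<forall>a\<in>set as. a \<ge> 1" "cf (0 # as) = x"
proof -
  obtain a b xs where as: "regular_expansion x (a # b # xs)"
    by (rule regular_expansionE)
  have "x \<le> of_int (a + 1)"
    using as cf_bounds[of "a # b # xs"] by (auto simp: regular_expansion_def)
  with assms have "(0::rat) < of_int (a + 1)"
    by (rule less_le_trans)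
  hence "a \<ge> 0"
    unfolding of_int_0_less_iff by simp
  show thesis
  proof (cases "a = 0")
    case True
    thus ?thesis using that(2)[of "b # xs"] as by (simp add: regular_expansion_def)
  next
    case False
    thus ?thesis using that(1)[of "a # b # xs"] as \<open>a \<ge> 0\<close> by (simp add: regular_expansion_def)
  qed
qed

lemma set_tl_subset: "\<forall>a\<in>set as. P a \<Longrightarrow> \<forall>a\<in>set (tl as). P a"
  by (cases as) auto

text \<open>A leading 0 contributes the q-integer 0 and the numerator 1. Prepending or deleting it
  therefore inverts the fraction and its deformation alike, with q replaced by its inverse.\<close>

lemma qrat_pos_inverse:
  assumes "q \<noteq> 0" "x > 0"
  shows "qrat q (1 / x) = 1 / qrat (inverse q) x"
  using assms(2)
proof (cases x rule: pos_expansion)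
  case (1 as)
  have "qrat (inverse q) x = qcf (inverse q) as"
    using 1 assms by (intro qrat_eqI set_tl_subset) auto
  moreover have "qrat q (1 / x) = qcf q (0 # as)"
    using 1 assms by (intro qrat_eqI) (auto simp: cf_Cons)
  ultimately show ?thesis using 1 by (simp add: qcf_Cons)
next
  case (2 as)
  have "qrat (inverse q) x = qcf (inverse q) (0 # as)"
    using 2 assms by (intro qrat_eqI) auto
  moreover have "qrat q (1 / x) = qcf q as"
    using 2 assms by (intro qrat_eqI set_tl_subset) (auto simp: cf_Cons)
  ultimately show ?thesis using 2 by (simp add: qcf_Cons)
qed

lemma qrat_pos:
  fixes q :: "'a::linordered_field"
  assumes "q > 0" "x > 0"
  shows "qrat q x > 0"
  using assms(2)
proof (cases x rule: pos_expansion)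
  case (1 as)
  have "qrat q x = qcf q as"
    using 1 assms by (intro qrat_eqI set_tl_subset) auto
  thus ?thesis using qcf_pos 1 assms by metis
next
  case (2 as)
  have "qrat q x = qcf q (0 # as)"
    using 2 assms by (intro qrat_eqI) auto
  thus ?thesis using qcf_pos[of "inverse q" as] 2 assms by (simp add: qcf_Cons)
qed

text \<open>With \<open>x = n + 1 / y\<close> and \<open>y > 1\<close>, use \<open>-x = -n - 1 + 1 / (1 + 1 / (y - 1))\<close>.\<close>

lemma qrat_uminus:
  fixes q :: "'a::linordered_field"
  assumes "q > 0"
  shows "qrat q (- x) = - (qrat (inverse q) x / q)"
\<comment> \<open>For an integer x there is no y = 1 / \<open>frac x\<close>, so
  \<open>qint_uminus\<close> is used instead.\<close>
proof (cases "frac x = 0")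
  case True
  then obtain n where "x = of_int n" by (auto simp: frac_eq_0_iff elim: Ints_cases)
  thus ?thesis
    using assms qrat_of_int[of q "- n"] by (simp add: qrat_of_int qint_uminus)
next
  case False
  define n y z where "n = \<lfloor>x\<rfloor>" and "y = 1 / frac x" and "z = y - 1"
  have "frac x > 0" "frac x < 1"
    using False frac_ge_0[of x] frac_lt_1[of x] by (auto simp: order_less_le)
  hence y: "y > 1" by (simp add: y_def)
  hence z: "z > 0" by (simp add: z_def)
  have x: "x = of_int n + 1 / y" by (simp add: n_def y_def frac_def)
  have "- x = of_int (- n - 1) + 1 / (of_int 1 + 1 / z)"
    using y by (simp add: x z_def field_simps)
  also have "qrat q \<dots> = qint q (- n - 1) + q powi (- n - 1) * (1 / (1 + inverse q * (1 / qrat q z)))"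
    using assms z by (simp add: qrat_of_int_add qrat_pos_inverse add_pos_pos del: of_int_1 of_int_diff of_int_minus)
  \<comment> \<open>With w = \<open>qrat q z\<close> both sides are q w / (1 + q w), since y = 1 + z
    is deformed to 1 + q w.\<close>
  also have "1 / (1 + inverse q * (1 / qrat q z)) = 1 - 1 / qrat q y"
  proof -
    have "qrat q y = 1 + q * qrat q z"
      using qrat_of_int_add[of q 1 z] assms by (simp add: z_def)
    moreover have "qrat q z > 0"
      using qrat_pos[of q z] assms z by simp
    moreover from this have "1 + q * qrat q z > 0"
      using assms by (simp add: add_pos_pos)
    ultimately show ?thesis
      using assms by (simp add: divide_simps)
  qed
  also have "qint q (- n - 1) + q powi (- n - 1) * (1 - 1 / qrat q y) =
      qint q (- n) - q powi (- n - 1) / qrat q y"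
    using qint_add_1[of q "- n - 1"] assms by (simp add: algebra_simps)
  also have "q powi (- n - 1) = inverse q powi n / q"
    using assms by (simp add: power_int_minus power_int_diff power_int_inverse field_simps)
  also have "qint q (- n) - inverse q powi n / q / qrat q y = - (qrat (inverse q) x / q)"
    using assms y qrat_of_int_add[of "inverse q" n "1 / y"] qrat_pos_inverse[of "inverse q" y]
    by (simp add: x qint_uminus add_divide_distrib)
  finally show ?thesis .
qed

text \<open>A negative x is negated before and after inverting; the two factors 1/q cancel.\<close>

lemma qrat_inverse:
  fixes q :: "'a::linordered_field"
  assumes "q > 0" "x \<noteq> 0"
  shows "qrat q (1 / x) = 1 / qrat (inverse q) x"
proof (cases "x > 0")
  case True
  thus ?thesis using assms by (simp add: qrat_pos_inverse)
next
  case False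
  have "qrat q (1 / x) = - (qrat (inverse q) (1 / - x) / q)"
    using qrat_uminus[OF assms(1), of "1 / - x"] by simp
  also have "\<dots> = - (1 / qrat q (- x) / q)"
    using qrat_pos_inverse[of "inverse q" "- x"] False assms by simp
  also have "\<dots> = 1 / qrat (inverse q) x"
    using assms by (simp add: qrat_uminus)
  finally show ?thesis .
qed

text \<open>Deformation preserves signs. Hence a denominator of the deformed fraction vanishes only
  if the rational one does.\<close>

lemma qrat_eq_0_iff:
  fixes q :: "'a::linordered_field"
  assumes "q > 0"
  shows "qrat q x = 0 \<longleftrightarrow> x = 0"
proof (cases "x < 0")
  case True
  hence "qrat (inverse q) (- x) > 0" using assms by (intro qrat_pos) auto
  thus ?thesis using qrat_uminus[OF assms, of "- x"] True assms by auto
next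
  case False
  thus ?thesis
    using qrat_pos[OF assms, of x] qrat_0[of q] assms by (cases "x = 0") auto
qed

section \<open>Continued fractions with arbitrary integer entries\<close>

text \<open>Each step y \<mapsto> a + 1/y is an inversion, which accounts for the switch to
  \<open>inverse q\<close>, followed by a translation.\<close>

lemma qcf_eq_qrat:
  fixes q :: "'a::linordered_field"
  assumes "q > 0" "as \<noteq> []" "cf_defined as"
  shows "qcf_defined q as \<and> qcf q as = qrat q (cf as)"
  using assms
proof (induction q as rule: qcf.induct)
  case (1 q a)
  thus ?case by (simp add: qrat_of_int)
next
  case (2 q a b xs)
  thus ?case by (simp add: qrat_eq_0_iff qrat_of_int_add qrat_inverse)
qed auto

text \<open>Each step y \<mapsto> c - 1/y is an inversion, a negation and a translation. The first
  two each invert q, so q itself returns, and the factor 1/q from negation lowers the exponent c to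
  c - 1.\<close>

lemma qhj_eq_qrat:
  fixes q :: "'a::linordered_field"
  assumes "q > 0" "cs \<noteq> []" "hj_defined cs"
  shows "qhj_defined q cs \<and> qhj q cs = qrat q (hj cs)"
  using assms
proof (induction q cs rule: qhj.induct)
  case (1 q c)
  thus ?case by (simp add: qrat_of_int)
next
  case (2 q c d xs)
  let ?y = "hj (d # xs)"
  have IH: "qhj_defined q (d # xs)" "qhj q (d # xs) = qrat q ?y" and y: "?y \<noteq> 0"
    using 2 by auto
  have "qrat q (hj (c # d # xs)) = qint q c + q powi c * qrat q (- (1 / ?y))"
    using qrat_of_int_add[of q c "- (1 / ?y)"] 2 by simp
  also have "qrat q (- (1 / ?y)) = - (1 / qrat q ?y / q)"
    using 2 y qrat_uminus[of q "1 / ?y"] qrat_inverse[of "inverse q" ?y] by simp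
  also have "q powi c * - (1 / qrat q ?y / q) = - (q powi (c - 1) / qrat q ?y)"
    using 2 by (simp add: power_int_diff)
  finally show ?case
    using IH y 2 by (simp add: qrat_eq_0_iff)
qed auto

text \<open>A polynomial has the sign of its leading coefficient, which is 1 for the
  variable.\<close>

lemma qvar_pos: "qvar > 0"
  by (simp add: qvar_def zero_less_Fract_iff less_poly_def pos_poly_def)

theorem theorem2p1:
  fixes a c :: "int list" and r s :: int and m k :: nat
  assumes "m \<ge> 1" and "length a = 2 * m"
    and "k \<ge> 1" and "length c = k"
    and "coprime r s" and "s > 0"
    and "cf_defined a" and "cf a = of_int r / of_int s"
    and "hj_defined c" and "hj c = of_int r / of_int s"
  shows "qcf_defined qvar a \<and> qhj_defined qvar c \<and>
         qcf qvar a = qhj qvar c \<and> qhj qvar c = qrat qvar (of_int r / of_int s)"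
proof -
  have "a \<noteq> []" "c \<noteq> []" using assms by auto
  thus ?thesis
    using qcf_eq_qrat[OF qvar_pos, of a] qhj_eq_qrat[OF qvar_pos, of c] assms by simp
qed

end
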